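(* Let $(U,p)$ be a complete partial metric space. For $z\in U$ let $T_z:U\to U$ be the constant mapping $T_z(x)=z$, $x\in U$. For $\alpha\in[0,1)$ say that a mapping $T:U\to U$ satisfies condition $C(\alpha)$ if $$p(T(x),T(y))\le \max\{\alpha p(x,y),\,p(x,x),\,p(y,y)\}\quad\text{for all }x,y\in U.$$ Then $U_p\neq\emptyset$ if and only if there is $z\in U$ such that $T_z$ satisfies $C(\alpha)$ for every $\alpha\in[0,1)$. Moreover, $$U_p=\{z\in U:\ T_z \text{ satisfies } C(\alpha)\text{ for some fixed }\alpha\in[0,1)\}.$$
   Context: Let $\mathbb{R}_+=[0,\infty)$. A partial metric on a nonempty set $U$ is a function $p:U\times U\to\mathbb{R}_+$ such that for all $x,y,z\in U$: (1) $x=y \Leftrightarrow p(x,x)=p(x,y)=p(y,y)$; (2) $p(x,x)\le p(y,x)$; (3) $p(x,y)=p(y,x)$; (4) $p(x,y)\le p(x,z)+p(z,y)-p(z,z)$. The pair $(U,p)$ is called a partial metric space. Put $\rho_p=\inf\{p(x,x):x\in U\}$ and $U_p=\{x\in U:p(x,x)=\rho_p\}$ (the bottom set, possibly empty). A sequence $(x_n)$ in $U$ is properly convergent to $x\in U$ if $\lim_{n\to\infty}p(x_n,x)=p(x,x)$ and $\lim_{n\to\infty}p(x_n,x_n)=p(x,x)$. A sequence $(x_n)$ is Cauchy if $\lim_{n,m\to\infty}p(x_n,x_m)$ exists and is finite. $(U,p)$ is complete if every Cauchy sequence of elements of $U$ is properly convergent to some element of $U$. *)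

theory Defs
  imports Complex_Main
begin

locale partial_metric_space =
  fixes U :: "'a set" and p :: "'a \<Rightarrow> 'a \<Rightarrow> real"
  assumes nonempty: "U \<noteq> {}"
    and nonneg: "\<lbrakk>x \<in> U; y \<in> U\<rbrakk> \<Longrightarrow> 0 \<le> p x y"
    and eq_iff: "\<lbrakk>x \<in> U; y \<in> U\<rbrakk> \<Longrightarrow> x = y \<longleftrightarrow> p x x = p x y \<and> p x y = p y y"
    and small_self: "\<lbrakk>x \<in> U; y \<in> U\<rbrakk> \<Longrightarrow> p x x \<le> p y x"
    and commute: "\<lbrakk>x \<in> U; y \<in> U\<rbrakk> \<Longrightarrow> p x y = p y x"
    and triangle: "\<lbrakk>x \<in> U; y \<in> U; z \<in> U\<rbrakk> \<Longrightarrow> p x y \<le> p x z + p z y - p z z"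

definition rho :: "'a set \<Rightarrow> ('a \<Rightarrow> 'a \<Rightarrow> real) \<Rightarrow> real" where
  "rho U p = (INF x\<in>U. p x x)"

definition bottom_set :: "'a set \<Rightarrow> ('a \<Rightarrow> 'a \<Rightarrow> real) \<Rightarrow> 'a set" where
  "bottom_set U p = {x \<in> U. p x x = rho U p}"

definition properly_converges ::
    "('a \<Rightarrow> 'a \<Rightarrow> real) \<Rightarrow> (nat \<Rightarrow> 'a) \<Rightarrow> 'a \<Rightarrow> bool" where
  "properly_converges p X x \<longleftrightarrow>
     (\<lambda>n. p (X n) x) \<longlonglongrightarrow> p x x \<and> (\<lambda>n. p (X n) (X n)) \<longlonglongrightarrow> p x x"

text \<open>The limit is a joint double limit as both indices tend to infinity; it is real, hence finite.\<close>

definition pm_Cauchy :: "('a \<Rightarrow> 'a \<Rightarrow> real) \<Rightarrow> (nat \<Rightarrow> 'a) \<Rightarrow> bool" where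
  "pm_Cauchy p X \<longleftrightarrow>
     (\<exists>L. ((\<lambda>(n, m). p (X n) (X m)) \<longlongrightarrow> L) (sequentially \<times>\<^sub>F sequentially))"

locale complete_partial_metric_space = partial_metric_space +
  assumes complete:
    "\<lbrakk>\<And>n. X n \<in> U; pm_Cauchy p X\<rbrakk> \<Longrightarrow> \<exists>x\<in>U. properly_converges p X x"

text \<open>
  The condition \<open>C(\<alpha>)\<close>. It is meant for \<open>\<alpha> \<in> {0..<1}\<close> and for \<open>T\<close> mapping
  \<open>U\<close> to itself; only the values of \<open>T\<close> on \<open>U\<close> matter.
\<close>

definition cond_C ::
    "'a set \<Rightarrow> ('a \<Rightarrow> 'a \<Rightarrow> real) \<Rightarrow> real \<Rightarrow> ('a \<Rightarrow> 'a) \<Rightarrow> bool" where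
  "cond_C U p \<alpha> T \<longleftrightarrow>
     (\<forall>x\<in>U. \<forall>y\<in>U. p (T x) (T y) \<le> max (\<alpha> * p x y) (max (p x x) (p y y)))"

definition const_map :: "'a \<Rightarrow> 'a \<Rightarrow> 'a" where
  "const_map z = (\<lambda>x. z)"

end

theory Submission
  imports Defs
begin

text \<open>
  For a constant map with value \<open>z\<close> the left-hand side of \<open>C(\<alpha>)\<close> is the number \<open>p z z\<close>, whatever
  the arguments are. On the diagonal \<open>x = y\<close> the right-hand side collapses to \<open>p x x\<close>, because
  \<open>\<alpha> \<le> 1\<close> and self-distances are nonnegative; off the diagonal it is at least \<open>p x x\<close>. Hence, for
  each single \<open>\<alpha>\<close>, \<open>C(\<alpha>)\<close> says that \<open>z\<close> has the least self-distance, that is, that \<open>z\<close> lies in the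
  bottom set. As this characterization is the same for all \<open>\<alpha>\<close>, "for some \<open>\<alpha>\<close>" and
  "for every \<open>\<alpha>\<close>" coincide, and both claims follow.
\<close>

context partial_metric_space
begin

text \<open>
  Nonnegativity bounds the self-distances from below, so the infimum is a genuine lower bound;
  a point attains it exactly when its own self-distance is a lower bound.
\<close>

lemma bottom_set_iff_minimal:
  assumes "z \<in> U"
  shows "z \<in> bottom_set U p \<longleftrightarrow> (\<forall>x\<in>U. p z z \<le> p x x)"
proof
  have bdd: "bdd_below ((\<lambda>x. p x x) ` U)"
    using nonneg by (intro bdd_belowI2[where m = 0]) auto
  show "\<forall>x\<in>U. p z z \<le> p x x" if "z \<in> bottom_set U p"
    using that cINF_lower[OF bdd] by (simp add: bottom_set_def rho_def)
  show "z \<in> bottom_set U p" if minimal: "\<forall>x\<in>U. p z z \<le> p x x"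
  proof -
    have "(INF x\<in>U. p x x) = p z z"
    proof (rule antisym)
      show "(INF x\<in>U. p x x) \<le> p z z"
        using assms by (rule cINF_lower[OF bdd])
      show "p z z \<le> (INF x\<in>U. p x x)"
        using minimal by (intro cINF_greatest[OF nonempty]) auto
    qed
    then show ?thesis
      using assms by (simp add: bottom_set_def rho_def)
  qed
qed

lemma cond_C_const_map_iff_bottom_set:
  assumes z: "z \<in> U" and \<alpha>: "\<alpha> \<le> 1"
  shows "cond_C U p \<alpha> (const_map z) \<longleftrightarrow> z \<in> bottom_set U p"
proof -
  have diagonal: "max (\<alpha> * p x x) (max (p x x) (p x x)) = p x x" if "x \<in> U" for x
    using mult_right_mono[OF \<alpha> nonneg[OF that that]] by simp
  have "cond_C U p \<alpha> (const_map z) \<longleftrightarrow> (\<forall>x\<in>U. p z z \<le> p x x)"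
  proof
    assume C: "cond_C U p \<alpha> (const_map z)"
    show "\<forall>x\<in>U. p z z \<le> p x x"
    proof
      fix x assume x: "x \<in> U"
      with C have "p z z \<le> max (\<alpha> * p x x) (max (p x x) (p x x))"
        unfolding cond_C_def const_map_def by blast
      then show "p z z \<le> p x x"
        by (simp only: diagonal[OF x])
    qed
  qed (simp add: cond_C_def const_map_def le_max_iff_disj)
  then show ?thesis
    by (simp add: bottom_set_iff_minimal[OF z])
qed

end

theorem theorem5p8:
  fixes U :: "'a set" and p :: "'a \<Rightarrow> 'a \<Rightarrow> real"
  assumes "complete_partial_metric_space U p"
  shows "(bottom_set U p \<noteq> {} \<longleftrightarrow>
           (\<exists>z\<in>U. \<forall>\<alpha>\<in>{0..<1}. cond_C U p \<alpha> (const_map z))) \<and>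
         bottom_set U p = {z \<in> U. \<exists>\<alpha>\<in>{0..<1}. cond_C U p \<alpha> (const_map z)}"
proof -
  interpret complete_partial_metric_space U p by fact
  have C_iff: "cond_C U p \<alpha> (const_map z) \<longleftrightarrow> z \<in> bottom_set U p"
    if "z \<in> U" "\<alpha> \<in> {0..<1}" for z \<alpha>
    using that by (intro cond_C_const_map_iff_bottom_set) auto
  have subset: "bottom_set U p \<subseteq> U"
    by (auto simp: bottom_set_def)
  (* "for every" implies "for some" only because the parameter range is inhabited, e.g. by 0 *)
  have range_nonempty: "(0::real) \<in> {0..<1}"
    by simp
  show ?thesis
    using C_iff subset range_nonempty by blast
qed

end
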